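(* Let $n\ge 1$ be an integer and let $U,U_1,\dots,U_n$ be independent and identically distributed random variables taking their values in $[0,1]$. For $t\in\{1,\dots,n\}$ let $$\bar U_t=\frac1t\sum_{i=1}^tU_i,\qquad \bar V_t=\frac1t\sum_{i=1}^t(U_i-\bar U_t)^2.$$ 1. For any $\varepsilon>0$, with probability at least $1-\varepsilon$, for any $t\in\{1,\dots,n\}$, with $\ell_t=\frac{n\log(2\varepsilon^{-1})}{t^2}$, we have $$\bar U_t-\mathbb EU<\min\left(\sqrt{2\ell_t(\bar V_t+\ell_t)}+\ell_t\Big(\frac13+\sqrt{1-3\bar V_t}\Big),\ \sqrt{\frac{\ell_t}{2}}\right).$$ 2. For any $\varepsilon>0$, with probability at least $1-\varepsilon$, for any $t\in\{1,\dots,n\}$, with $\tilde\ell_t=\frac{n\log(3\varepsilon^{-1})}{t^2}$, we have $$\big|\bar U_t-\mathbb EU\big|<\min\left(\sqrt{2\tilde\ell_t(\bar V_t+\tilde\ell_t)}+\tilde\ell_t\Big(\frac13+\sqrt{1-3\bar V_t}\Big),\ \sqrt{\frac{\tilde\ell_t}{2}}\right).$$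
   Context: In each part the inequality holds simultaneously for all $t\in\{1,\dots,n\}$ on a single event of probability at least $1-\varepsilon$. Note that $\bar V_t\le 1/4$ since the $U_i$ lie in $[0,1]$, so $\sqrt{1-3\bar V_t}$ is well defined. *)

theory Defs
  imports "HOL-Probability.Probability"
begin

definition emp_mean :: "(nat \<Rightarrow> real) \<Rightarrow> nat \<Rightarrow> real" where
  "emp_mean x t = (\<Sum>i=1..t. x i) / real t"

definition emp_var :: "(nat \<Rightarrow> real) \<Rightarrow> nat \<Rightarrow> real" where
  "emp_var x t = (\<Sum>i=1..t. (x i - emp_mean x t)\<^sup>2) / real t"

definition emp_bernstein_bound :: "real \<Rightarrow> real \<Rightarrow> real" where
  "emp_bernstein_bound l v =
     min (sqrt (2 * l * (v + l)) + l * (1 / 3 + sqrt (1 - 3 * v))) (sqrt (l / 2))"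

end

theory Submission
  imports Defs
begin

text \<open>
  Write \<open>L\<close> for the logarithmic term and \<open>\<mu>\<close>, \<open>\<sigma>\<^sup>2\<close>, \<open>\<kappa>\<close> for the mean, variance and fourth central
  moment of the common distribution. Two deviation events of probability at most \<open>exp (- L)\<close> each
  suffice for the one-sided bound.

  On the complement of the first (\<open>upper_deviation\<close>), the centred partial sums stay below the smaller
  of the Bernstein level \<open>sqrt (2 n \<sigma>\<^sup>2 L) + L / 3\<close> and the Hoeffding level \<open>sqrt (n L / 2)\<close> for all
  \<open>t \<le> n\<close> simultaneously. On the complement of the second (\<open>variance_lower_deviation\<close>), the partial
  sums of \<open>\<sigma>\<^sup>2 - (X i - \<mu>)\<^sup>2\<close> stay below \<open>sqrt (2 n \<kappa> L)\<close>. Uniformity in \<open>t\<close> costs nothing compared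
  with the fixed time \<open>n\<close>, because exponentials of partial sums, suitably normalised, are
  supermartingales and satisfy a maximal inequality (\<open>product_maximal_inequality\<close>,
  \<open>maximal_chernoff\<close>).

  The second event is a lower confidence statement for the empirical variance. The sharp inequality
  \<open>\<kappa> \<le> \<sigma>\<^sup>2 (1 - 3 \<sigma>\<^sup>2)\<close> (\<open>fourth_central_moment_le\<close>) turns it into a quadratic inequality for
  \<open>\<sigma>\<close>, whose solution bounds \<open>\<sigma>\<close> by \<open>sqrt (V + l) + sqrt (l (1 - 3 V) / 2)\<close>, where \<open>V\<close> is the
  empirical variance and \<open>l = n L / t\<^sup>2\<close>; the squared deviation of the empirical mean, which separates
  \<open>V\<close> from the mean of the \<open>(X i - \<mu>)\<^sup>2\<close>, is absorbed by the Hoeffding bound. Substituting this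
  into the Bernstein bound is the content of \<open>less_emp_bernstein_bound\<close>.

  The two-sided bound adds the first event for the reflected sample \<open>1 - X i\<close>. With \<open>L = ln (2 / \<epsilon>)\<close>
  and \<open>L = ln (3 / \<epsilon>)\<close> respectively, the two or three events have total probability at most \<open>\<epsilon>\<close>.
\<close>

section \<open>A maximal inequality for products of independent variables\<close>

text \<open>
  The partial products of \<open>y\<close>, frozen from the first time that they reach the level \<open>a\<close>: the
  optionally stopped version of the product process.
\<close>

primrec stopped_prod :: "real \<Rightarrow> (nat \<Rightarrow> real) \<Rightarrow> nat \<Rightarrow> real" where
  "stopped_prod a y 0 = 1"
| "stopped_prod a y (Suc t) =
     (if a \<le> stopped_prod a y t then stopped_prod a y t else stopped_prod a y t * y (Suc t))"

text \<open>
  Freezing turns the existence of a passage time into a statement about the last time alone, so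
  that Markov's inequality can be applied.
\<close>

lemma stopped_prod_reaches:
  assumes "t \<in> {1..n}" and "a \<le> (\<Prod>i=1..t. y i)"
  shows "a \<le> stopped_prod a y n"
proof -
  have "a \<le> stopped_prod a y n \<or>
      (stopped_prod a y n = (\<Prod>i=1..n. y i) \<and> (\<forall>t\<in>{1..n}. (\<Prod>i=1..t. y i) < a))"
    by (induction n) (auto simp: not_le le_Suc_eq)
  then show ?thesis
    using assms by force
qed

lemma stopped_prod_nonneg:
  "(\<And>i. i \<in> {1..t} \<Longrightarrow> 0 \<le> y i) \<Longrightarrow> 0 \<le> stopped_prod a y t"
  by (induction t) auto

lemma stopped_prod_cong:
  "(\<And>i. i \<in> {1..t} \<Longrightarrow> y i = z i) \<Longrightarrow> stopped_prod a y t = stopped_prod a z t"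
  by (induction t) auto

lemma measurable_stopped_prod:
  assumes "{1..t} \<subseteq> I"
  shows "(\<lambda>y. stopped_prod a y t) \<in> borel_measurable (PiM I (\<lambda>_. borel))"
  using assms
proof (induction t)
  case (Suc t)
  have [measurable]: "(\<lambda>y. y (Suc t)) \<in> borel_measurable (PiM I (\<lambda>_. borel :: real measure))"
    using Suc.prems by (intro measurable_component_singleton) auto
  have [measurable]: "(\<lambda>y. stopped_prod a y t) \<in> borel_measurable (PiM I (\<lambda>_. borel))"
    using Suc.prems by (intro Suc.IH) auto
  show ?case by simp
qed simp

context prob_space
begin

text \<open>
  This is Ville's inequality for the supermartingale of partial products. Freezing does not
  increase expectations: the next factor multiplies only the part of the process that is not yet
  frozen, which is a function of the earlier variables, hence independent of that factor, whose
  mean is at most \<open>1\<close>. So the frozen product has mean at most \<open>1\<close> at time \<open>n\<close>, and Markov's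
  inequality gives the claim.
\<close>

lemma product_maximal_inequality:
  fixes Y :: "nat \<Rightarrow> 'a \<Rightarrow> real" and a :: real
  assumes indep: "indep_vars (\<lambda>_. borel) Y {1..n}"
    and int: "\<And>i. i \<in> {1..n} \<Longrightarrow> integrable M (Y i)"
    and nonneg: "\<And>i \<omega>. i \<in> {1..n} \<Longrightarrow> \<omega> \<in> space M \<Longrightarrow> 0 \<le> Y i \<omega>"
    and mean: "\<And>i. i \<in> {1..n} \<Longrightarrow> expectation (Y i) \<le> 1"
    and "a > 0"
  shows "prob {\<omega> \<in> space M. \<exists>t\<in>{1..n}. a \<le> (\<Prod>i=1..t. Y i \<omega>)} \<le> 1 / a"
proof -
  define N where "N t \<omega> = stopped_prod a (\<lambda>i. Y i \<omega>) t" for t \<omega>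
  have N_nonneg: "0 \<le> N t \<omega>" if "t \<le> n" "\<omega> \<in> space M" for t \<omega>
    unfolding N_def using that nonneg by (intro stopped_prod_nonneg) auto
  have N_step: "integrable M (N t) \<and> expectation (N t) \<le> 1" if "t \<le> n" for t
    using that
  proof (induction t)
    case 0
    have "N 0 = (\<lambda>_. 1)" by (auto simp: N_def)
    then show ?case by (simp add: prob_space)
  next
    case (Suc t)
    then have t: "Suc t \<in> {1..n}" "t \<le> n" by auto
    have intN[measurable]: "integrable M (N t)" and exN: "expectation (N t) \<le> 1"
      using Suc by auto
    \<comment> \<open>\<open>G\<close> is the part of the process that is still running; the rest keeps its value.\<close>
    define go where "go x = (if a \<le> x then 0 else x)" for x :: real
    define G where "G \<omega> = go (N t \<omega>)" for \<omega>
    have go[measurable]: "go \<in> borel_measurable borel"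
      unfolding go_def by measurable
    have [measurable]: "random_variable borel G"
      unfolding G_def[abs_def] by measurable
    have intY: "integrable M (Y (Suc t))" using int t by auto
    have intG: "integrable M G"
      by (rule Bochner_Integration.integrable_bound[OF intN]) (auto simp: G_def go_def)
    have G_nonneg: "0 \<le> expectation G"
      using N_nonneg t(2) by (intro integral_nonneg_AE AE_I2) (auto simp: G_def go_def)
    have "indep_var (PiM {1..t} (\<lambda>_. borel)) (\<lambda>\<omega>. restrict (\<lambda>i. Y i \<omega>) {1..t})
                    (PiM {Suc t} (\<lambda>_. borel)) (\<lambda>\<omega>. restrict (\<lambda>i. Y i \<omega>) {Suc t})"
      using t by (intro indep_var_restrict[OF indep]) auto
    from indep_var_compose[OF this, of "\<lambda>y. go (stopped_prod a y t)" borel "\<lambda>y. y (Suc t)" borel]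
    have ind: "indep_var borel ((\<lambda>y. go (stopped_prod a y t)) \<circ> (\<lambda>\<omega>. restrict (\<lambda>i. Y i \<omega>) {1..t}))
         borel ((\<lambda>y. y (Suc t)) \<circ> (\<lambda>\<omega>. restrict (\<lambda>i. Y i \<omega>) {Suc t}))"
      using measurable_compose[OF measurable_stopped_prod go, of t "{1..t}" a]
      by (auto intro!: measurable_component_singleton)
    have G_eq: "(\<lambda>y. go (stopped_prod a y t)) \<circ> (\<lambda>\<omega>. restrict (\<lambda>i. Y i \<omega>) {1..t}) = G"
      unfolding G_def N_def o_def
      by (intro ext arg_cong[where f = go] stopped_prod_cong) auto
    have Y_eq: "(\<lambda>y. y (Suc t)) \<circ> (\<lambda>\<omega>. restrict (\<lambda>i. Y i \<omega>) {Suc t}) = Y (Suc t)"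
      by auto
    have indGY: "indep_var borel G borel (Y (Suc t))"
      using ind unfolding G_eq Y_eq .
    have N_Suc: "N (Suc t) = (\<lambda>\<omega>. (N t \<omega> - G \<omega>) + G \<omega> * Y (Suc t) \<omega>)"
      by (auto simp: N_def G_def go_def)
    have intGY: "integrable M (\<lambda>\<omega>. G \<omega> * Y (Suc t) \<omega>)"
      by (rule indep_var_integrable[OF indGY intG intY])
    have "expectation (N (Suc t)) = expectation (N t) - expectation G + expectation G * expectation (Y (Suc t))"
      unfolding N_Suc using intN intG intGY indep_var_lebesgue_integral[OF indGY intG intY] by simp
    also have "\<dots> \<le> expectation (N t)"
      using mult_left_mono[OF mean[OF t(1)] G_nonneg] by simp
    finally show ?case
      using exN intN intG intGY by (auto simp: N_Suc)
  qed
  then have intN[measurable]: "integrable M (N n)" and exN: "expectation (N n) \<le> 1" by auto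
  have "prob {\<omega> \<in> space M. \<exists>t\<in>{1..n}. a \<le> (\<Prod>i=1..t. Y i \<omega>)} \<le> prob {\<omega> \<in> space M. a \<le> N n \<omega>}"
    unfolding N_def[abs_def]
    by (rule finite_measure_mono) (use stopped_prod_reaches intN in \<open>auto simp: N_def[abs_def]\<close>)
  also have "\<dots> \<le> expectation (N n) / a"
    by (rule integral_Markov_inequality_measure[OF intN sets.top])
      (use N_nonneg \<open>a > 0\<close> in auto)
  also have "\<dots> \<le> 1 / a"
    using exN \<open>a > 0\<close> by (intro divide_right_mono) auto
  finally show ?thesis .
qed

text \<open>
  The price of taking a maximum over all \<open>t \<le> n\<close> is nothing beyond the Chernoff bound at time
  \<open>n\<close>: since \<open>c \<ge> 0\<close>, the normalised exponential \<open>exp (l * S t - t * c)\<close> is smallest, for a given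
  value of the partial sum \<open>S t\<close>, at the final time.
\<close>

lemma maximal_chernoff:
  fixes Z :: "nat \<Rightarrow> 'a \<Rightarrow> real"
  assumes indep: "indep_vars (\<lambda>_. borel) Z {1..n}"
    and int: "\<And>i. i \<in> {1..n} \<Longrightarrow> integrable M (\<lambda>\<omega>. exp (l * Z i \<omega>))"
    and mgf: "\<And>i. i \<in> {1..n} \<Longrightarrow> expectation (\<lambda>\<omega>. exp (l * Z i \<omega>)) \<le> exp c"
    and "0 \<le> l" and "0 \<le> c"
  shows "prob {\<omega> \<in> space M. \<exists>t\<in>{1..n}. s \<le> (\<Sum>i=1..t. Z i \<omega>)} \<le> exp (real n * c - l * s)"
proof -
  define Y where "Y i \<omega> = exp (l * Z i \<omega>) * exp (- c)" for i \<omega>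
  define a where "a = exp (l * s - real n * c)"
  have indepY: "indep_vars (\<lambda>_. borel) Y {1..n}"
    unfolding Y_def[abs_def] by (rule indep_vars_compose2[OF indep]) measurable
  have rv: "random_variable borel (Y i)" if "i \<in> {1..n}" for i
    using indepY that by (auto simp: indep_vars_def)
  have prod_Y: "(\<Prod>i=1..t. Y i \<omega>) = exp (l * (\<Sum>i=1..t. Z i \<omega>) - real t * c)" for t \<omega>
    by (induction t) (auto simp: Y_def exp_add[symmetric] algebra_simps)
  have meas: "{\<omega> \<in> space M. \<exists>t\<in>{1..n}. a \<le> (\<Prod>i=1..t. Y i \<omega>)} \<in> events"
    using rv by (intro sets.sets_Collect_finite_Ex borel_measurable_le borel_measurable_prod) auto
  have "prob {\<omega> \<in> space M. \<exists>t\<in>{1..n}. s \<le> (\<Sum>i=1..t. Z i \<omega>)}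
      \<le> prob {\<omega> \<in> space M. \<exists>t\<in>{1..n}. a \<le> (\<Prod>i=1..t. Y i \<omega>)}"
  proof (rule finite_measure_mono[OF _ meas], safe)
    fix \<omega> t assume t: "t \<in> {1..n}" "s \<le> (\<Sum>i=1..t. Z i \<omega>)"
    have "real t * c \<le> real n * c" using t \<open>0 \<le> c\<close> by (intro mult_right_mono) auto
    moreover have "l * s \<le> l * (\<Sum>i=1..t. Z i \<omega>)" using t \<open>0 \<le> l\<close> by (intro mult_left_mono)
    ultimately show "\<exists>t\<in>{1..n}. a \<le> (\<Prod>i=1..t. Y i \<omega>)"
      unfolding prod_Y a_def using t(1) by (intro bexI[of _ t]) auto
  qed
  also have "\<dots> \<le> 1 / a"
  proof (rule product_maximal_inequality[OF indepY])
    fix i assume i: "i \<in> {1..n}"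
    show "integrable M (Y i)" unfolding Y_def[abs_def] using int[OF i] by simp
    have "expectation (Y i) = expectation (\<lambda>\<omega>. exp (l * Z i \<omega>)) * exp (- c)"
      unfolding Y_def[abs_def] by simp
    also have "\<dots> \<le> exp c * exp (- c)" by (intro mult_right_mono mgf i) auto
    finally show "expectation (Y i) \<le> 1" by (simp add: exp_minus)
  qed (auto simp: Y_def a_def)
  also have "1 / a = exp (real n * c - l * s)"
    unfolding a_def by (simp add: exp_diff)
  finally show ?thesis .
qed
end

section \<open>Bounds on moment generating functions\<close>

lemma exp_le_quadratic_nonpos:
  fixes x :: real
  assumes "x \<le> 0"
  shows "exp x \<le> 1 + x + x\<^sup>2 / 2"
proof -
  have "1 + x + x\<^sup>2 / 2 - exp x \<ge> 1 + 0 + 0\<^sup>2 / 2 - exp (0::real)"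
  proof (rule DERIV_nonpos_imp_nonincreasing[OF assms])
    fix y :: real
    have "((\<lambda>x. 1 + x + x\<^sup>2 / 2 - exp x) has_real_derivative (1 + y - exp y)) (at y)"
      by (auto intro!: derivative_eq_intros)
    then show "\<exists>D. ((\<lambda>x. 1 + x + x\<^sup>2 / 2 - exp x) has_real_derivative D) (at y) \<and> D \<le> 0"
      using exp_ge_add_one_self[of y] by (intro exI[of _ "1 + y - exp y"]) auto
  qed
  then show ?thesis by simp
qed

text \<open>
  The difference of the two sides vanishes to first order at \<open>0\<close>, and it is convex because its
  second derivative \<open>(1 - (1 - x) * exp x) / 3\<close> is nonnegative by \<open>1 - x \<le> exp (- x)\<close>.
\<close>

lemma bernstein_exp_bound_nonneg:
  fixes x :: real
  assumes "0 \<le> x"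
  shows "(1 - x / 3) * (exp x - 1 - x) \<le> x\<^sup>2 / 2"
proof -
  define f :: "real \<Rightarrow> real" where "f x = x\<^sup>2 / 2 - (1 - x / 3) * (exp x - 1 - x)" for x
  define f' :: "real \<Rightarrow> real" where "f' x = x / 3 + 2 / 3 - 2 / 3 * exp x + x * exp x / 3" for x
  have df: "(f has_real_derivative f' y) (at y)" for y
    unfolding f_def f'_def by (auto intro!: derivative_eq_intros simp: field_simps)
  have df': "(f' has_real_derivative (1 - (1 - y) * exp y) / 3) (at y)" for y
    unfolding f'_def by (auto intro!: derivative_eq_intros simp: field_simps)
  have nonneg'': "0 \<le> (1 - (1 - y) * exp y) / 3" for y :: real
  proof -
    have "(1 - y) * exp y \<le> exp (- y) * exp y"
      using exp_ge_add_one_self[of "- y"] by (intro mult_right_mono) auto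
    then show ?thesis by (simp add: exp_minus)
  qed
  have nonneg': "0 \<le> f' y" if "0 \<le> y" for y
  proof -
    have "f' 0 \<le> f' y"
      using that df' nonneg'' by (intro DERIV_nonneg_imp_nondecreasing[of 0 y f']) blast+
    then show ?thesis by (simp add: f'_def)
  qed
  have "f 0 \<le> f x"
    using df nonneg' by (intro DERIV_nonneg_imp_nondecreasing[OF assms]) blast
  then show ?thesis by (simp add: f_def)
qed

text \<open>
  A quadratic majorant of the exponential that is uniform over \<open>x \<le> l\<close>: this is where a one-sided
  bound on a variable enters Bernstein's inequality.
\<close>

lemma bernstein_exp_bound:
  fixes x l :: real
  assumes "x \<le> l" "0 \<le> l" "l < 3"
  shows "exp x \<le> 1 + x + x\<^sup>2 / (2 * (1 - l / 3))"
proof (cases "0 \<le> x")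
  case True
  have "exp x - 1 - x \<le> x\<^sup>2 / (2 * (1 - x / 3))"
    using bernstein_exp_bound_nonneg[OF True] assms by (simp add: field_simps)
  also have "\<dots> \<le> x\<^sup>2 / (2 * (1 - l / 3))"
    using assms by (intro divide_left_mono) auto
  finally show ?thesis by simp
next
  case False
  have "x\<^sup>2 / 2 \<le> x\<^sup>2 / (2 * (1 - l / 3))"
    using assms by (intro divide_left_mono) auto
  then show ?thesis using exp_le_quadratic_nonpos[of x] False by linarith
qed

context prob_space
begin

lemma bernstein_mgf:
  fixes Z :: "'a \<Rightarrow> real"
  assumes rv[measurable]: "random_variable borel Z"
    and bdd: "\<And>\<omega>. \<omega> \<in> space M \<Longrightarrow> \<bar>Z \<omega>\<bar> \<le> 1"
    and mean: "expectation Z = 0" and l: "0 \<le> l" "l < 3"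
  shows "expectation (\<lambda>\<omega>. exp (l * Z \<omega>))
    \<le> exp (expectation (\<lambda>\<omega>. (Z \<omega>)\<^sup>2) * (l\<^sup>2 / (2 * (1 - l / 3))))"
proof -
  let ?k = "l\<^sup>2 / (2 * (1 - l / 3))"
  have le_l: "l * Z \<omega> \<le> l" if "\<omega> \<in> space M" for \<omega>
    using bdd[OF that] mult_left_mono[of "Z \<omega>" 1 l] l by auto
  have [simp]: "integrable M Z"
    using bdd by (intro integrable_const_bound[where B = 1]) auto
  have [simp]: "integrable M (\<lambda>\<omega>. (Z \<omega>)\<^sup>2)"
    using bdd by (intro integrable_const_bound[where B = 1]) (auto simp: abs_square_le_1)
  have [simp]: "integrable M (\<lambda>\<omega>. exp (l * Z \<omega>))"
    using le_l by (intro integrable_const_bound[where B = "exp l"]) auto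
  have "expectation (\<lambda>\<omega>. exp (l * Z \<omega>)) \<le> expectation (\<lambda>\<omega>. 1 + l * Z \<omega> + (Z \<omega>)\<^sup>2 * ?k)"
  proof (rule integral_mono)
    fix \<omega> assume "\<omega> \<in> space M"
    from bernstein_exp_bound[OF le_l[OF this] l]
    show "exp (l * Z \<omega>) \<le> 1 + l * Z \<omega> + (Z \<omega>)\<^sup>2 * ?k"
      by (simp add: power_mult_distrib mult.commute)
  qed auto
  also have "\<dots> = 1 + expectation (\<lambda>\<omega>. (Z \<omega>)\<^sup>2) * ?k"
    by (simp add: mean prob_space)
  also have "\<dots> \<le> exp (expectation (\<lambda>\<omega>. (Z \<omega>)\<^sup>2) * ?k)"
    by (rule exp_ge_add_one_self)
  finally show ?thesis .
qed

text \<open>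
  For a nonnegative variable, the exponential of its negative is dominated by its second-order
  Taylor polynomial. The lower tail is therefore purely sub-Gaussian, with the second moment as
  variance proxy and no linear correction term.
\<close>

lemma nonneg_lower_mgf:
  fixes W :: "'a \<Rightarrow> real"
  assumes rv[measurable]: "random_variable borel W"
    and nonneg: "\<And>\<omega>. \<omega> \<in> space M \<Longrightarrow> 0 \<le> W \<omega>"
    and int[simp]: "integrable M W" "integrable M (\<lambda>\<omega>. (W \<omega>)\<^sup>2)"
    and l: "0 \<le> l"
  shows "expectation (\<lambda>\<omega>. exp (l * (expectation W - W \<omega>)))
    \<le> exp (l\<^sup>2 * expectation (\<lambda>\<omega>. (W \<omega>)\<^sup>2) / 2)"
proof -
  let ?m = "expectation W" and ?q = "expectation (\<lambda>\<omega>. (W \<omega>)\<^sup>2)"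
  have neg: "l * - W \<omega> \<le> 0" if "\<omega> \<in> space M" for \<omega>
    using nonneg[OF that] l by auto
  have [simp]: "integrable M (\<lambda>\<omega>. exp (l * - W \<omega>))"
    using neg by (intro integrable_const_bound[where B = 1]) auto
  have "expectation (\<lambda>\<omega>. exp (l * - W \<omega>)) \<le> expectation (\<lambda>\<omega>. 1 - l * W \<omega> + (W \<omega>)\<^sup>2 * (l\<^sup>2 / 2))"
  proof (rule integral_mono)
    fix \<omega> assume "\<omega> \<in> space M"
    from exp_le_quadratic_nonpos[OF neg[OF this]]
    show "exp (l * - W \<omega>) \<le> 1 - l * W \<omega> + (W \<omega>)\<^sup>2 * (l\<^sup>2 / 2)"
      by (simp add: power_mult_distrib mult.commute)
  qed (simp_all only: \<open>integrable M (\<lambda>\<omega>. exp (l * - W \<omega>))\<close>, auto)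
  also have "\<dots> = 1 + (?q * (l\<^sup>2 / 2) - l * ?m)"
    by (simp add: prob_space)
  also have "\<dots> \<le> exp (?q * (l\<^sup>2 / 2) - l * ?m)"
    by (rule exp_ge_add_one_self)
  finally have *: "expectation (\<lambda>\<omega>. exp (l * - W \<omega>)) \<le> exp (?q * (l\<^sup>2 / 2) - l * ?m)" .
  have "expectation (\<lambda>\<omega>. exp (l * (?m - W \<omega>))) = exp (l * ?m) * expectation (\<lambda>\<omega>. exp (l * - W \<omega>))"
    by (subst integral_mult_right_zero[symmetric])
      (simp add: exp_add[symmetric] algebra_simps)
  also have "\<dots> \<le> exp (l * ?m) * exp (?q * (l\<^sup>2 / 2) - l * ?m)"
    by (intro mult_left_mono *) auto
  also have "\<dots> = exp (l\<^sup>2 * ?q / 2)"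
    by (simp add: exp_add[symmetric] algebra_simps)
  finally show ?thesis .
qed

section \<open>Inequalities between central moments\<close>

text \<open>
  Symmetrisation: for an independent copy \<open>Y\<close> of \<open>X\<close> one has \<open>\<bar>X - Y\<bar> \<le> 1\<close>, so the fourth moment
  of \<open>X - Y\<close>, which is twice the fourth central moment plus \<open>6 * v\<^sup>2\<close>, is at most its second
  moment \<open>2 * v\<close>. The copy is replaced here by integrating \<open>(x - y) ^ 4 \<le> (x - y)\<^sup>2\<close> first in
  \<open>x\<close> and then in \<open>y\<close>. Equality holds for Bernoulli variables.
\<close>

lemma fourth_central_moment_le:
  fixes X :: "'a \<Rightarrow> real"
  assumes rv[measurable]: "random_variable borel X"
    and bdd: "\<And>\<omega>. \<omega> \<in> space M \<Longrightarrow> X \<omega> \<in> {0..1}"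
  defines "m \<equiv> expectation X"
  defines "v \<equiv> expectation (\<lambda>\<omega>. (X \<omega> - m)\<^sup>2)"
  shows "expectation (\<lambda>\<omega>. (X \<omega> - m) ^ 4) \<le> v * (1 - 3 * v)"
proof -
  have int_poly: "integrable M (\<lambda>\<omega>. (X \<omega> - m) ^ k)" for k
    using bdd by (intro integrable_const_bound[where B = "(1 + \<bar>m\<bar>) ^ k"])
      (force intro!: AE_I2 power_mono simp: power_abs)+
  note [simp] = int_poly int_poly[of 1, simplified] int_poly[of 2] int_poly[of 3] int_poly[of 4]
  have intX: "integrable M X"
    using bdd by (intro integrable_const_bound[where B = 1]) auto
  have e1: "expectation (\<lambda>\<omega>. X \<omega> - m) = 0"
    using intX by (simp add: prob_space m_def)
  define q where "q = expectation (\<lambda>\<omega>. (X \<omega> - m) ^ 4)"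
  define r where "r = expectation (\<lambda>\<omega>. (X \<omega> - m) ^ 3)"
  \<comment> \<open>Here \<open>w\<close> stands for \<open>y - m\<close>, and the integral is over \<open>x\<close>; the term in \<open>r\<close> is linear in \<open>w\<close>
    and disappears in the second integration.\<close>
  have inner: "q - 4 * w * r + 6 * w\<^sup>2 * v + w ^ 4 \<le> v + w\<^sup>2"
    if w: "w + m \<in> {0..1}" for w
  proof -
    have "expectation (\<lambda>\<omega>. (X \<omega> - m) ^ 4 - 4 * w * (X \<omega> - m) ^ 3 + 6 * w\<^sup>2 * (X \<omega> - m)\<^sup>2
          - 4 * w ^ 3 * (X \<omega> - m) + w ^ 4)
        \<le> expectation (\<lambda>\<omega>. (X \<omega> - m)\<^sup>2 - 2 * w * (X \<omega> - m) + w\<^sup>2)"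
    proof (rule integral_mono)
      fix \<omega> assume \<omega>: "\<omega> \<in> space M"
      have "((X \<omega> - m) - w)\<^sup>2 \<le> 1"
        using bdd[OF \<omega>] w by (auto simp: abs_square_le_1)
      then have "((X \<omega> - m) - w)\<^sup>2 * ((X \<omega> - m) - w)\<^sup>2 \<le> 1 * ((X \<omega> - m) - w)\<^sup>2"
        by (intro mult_right_mono) auto
      then show "(X \<omega> - m) ^ 4 - 4 * w * (X \<omega> - m) ^ 3 + 6 * w\<^sup>2 * (X \<omega> - m)\<^sup>2
          - 4 * w ^ 3 * (X \<omega> - m) + w ^ 4 \<le> (X \<omega> - m)\<^sup>2 - 2 * w * (X \<omega> - m) + w\<^sup>2"
        by (simp only: power2_eq_square power3_eq_cube power4_eq_xxxx) (simp add: algebra_simps)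
    qed auto
    then show ?thesis
      by (simp add: e1 prob_space q_def r_def v_def)
  qed
  have "expectation (\<lambda>\<omega>. q - 4 * r * (X \<omega> - m) + 6 * v * (X \<omega> - m)\<^sup>2 + (X \<omega> - m) ^ 4)
      \<le> expectation (\<lambda>\<omega>. v + (X \<omega> - m)\<^sup>2)"
  proof (rule integral_mono)
    fix \<omega> assume \<omega>: "\<omega> \<in> space M"
    show "q - 4 * r * (X \<omega> - m) + 6 * v * (X \<omega> - m)\<^sup>2 + (X \<omega> - m) ^ 4 \<le> v + (X \<omega> - m)\<^sup>2"
      using inner[of "X \<omega> - m"] bdd[OF \<omega>] by (simp add: algebra_simps)
  qed auto
  then have "q + 6 * v * v + q \<le> v + v"
    by (simp add: e1 prob_space q_def[symmetric] v_def[symmetric])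
  then show ?thesis
    by (simp add: q_def[symmetric] algebra_simps)
qed

lemma square_variance_le_fourth_moment:
  fixes Z :: "'a \<Rightarrow> real"
  assumes [simp]: "integrable M (\<lambda>\<omega>. (Z \<omega>)\<^sup>2)" "integrable M (\<lambda>\<omega>. Z \<omega> ^ 4)"
  shows "(expectation (\<lambda>\<omega>. (Z \<omega>)\<^sup>2))\<^sup>2 \<le> expectation (\<lambda>\<omega>. Z \<omega> ^ 4)"
proof -
  define v where "v = expectation (\<lambda>\<omega>. (Z \<omega>)\<^sup>2)"
  have "0 \<le> expectation (\<lambda>\<omega>. ((Z \<omega>)\<^sup>2 - v)\<^sup>2)"
    by (rule integral_nonneg_AE) auto
  also have "\<dots> = expectation (\<lambda>\<omega>. Z \<omega> ^ 4 - 2 * v * (Z \<omega>)\<^sup>2 + v\<^sup>2)"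
    by (intro Bochner_Integration.integral_cong) (auto simp: power2_eq_square power4_eq_xxxx algebra_simps)
  also have "\<dots> = expectation (\<lambda>\<omega>. Z \<omega> ^ 4) - v\<^sup>2"
    by (simp add: prob_space v_def[symmetric]) (simp add: power2_eq_square)
  finally show ?thesis by (simp add: v_def)
qed

end

section \<open>Deterministic comparison along a sample path\<close>

text \<open>
  Here the unknown variance \<open>s\<close> is replaced by the empirical variance \<open>v\<close>; \<open>d\<close> is the deviation
  of the empirical mean and \<open>q\<close> the fourth central moment. It suffices to compare the Bernstein
  bound at \<open>s\<close> with the empirical bound when \<open>d > 0\<close> and \<open>v < s\<close>. With
  \<open>c = sqrt (l * (1 - 3 * s) / 2)\<close>, the variance hypothesis becomes
  \<open>s - 2 * c * sqrt s < v + l / 2\<close>, because the Hoeffding bound gives \<open>d\<^sup>2 < l / 2\<close>. Completing the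
  square gives \<open>sqrt s \<le> c + sqrt (v + l)\<close>, and \<open>c\<close> only grows when \<open>s\<close> is replaced by the smaller
  \<open>v\<close>.
\<close>

lemma less_emp_bernstein_bound:
  assumes l: "0 < l" and v: "0 \<le> v" "v \<le> 1 / 4"
    and hoeffding: "d < sqrt (l / 2)"
    and bernstein: "d < sqrt (2 * l * s) + l / 3"
    and s: "0 \<le> s" and q: "0 \<le> q" "q \<le> s * (1 - 3 * s)"
    and variance: "0 < s \<Longrightarrow> s - (v + d\<^sup>2) < sqrt (2 * l * q)"
  shows "d < emp_bernstein_bound l v"
proof -
  have root_v: "0 \<le> sqrt (1 - 3 * v)" using v by auto
  have "d < sqrt (2 * l * (v + l)) + l * (1 / 3 + sqrt (1 - 3 * v))"
  proof (cases "0 < d \<and> v < s")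
    case False
    then consider "d \<le> 0" | "s \<le> v" by linarith
    then show ?thesis
    proof cases
      case 1
      have "0 < sqrt (2 * l * (v + l))" "0 \<le> l * (1 / 3 + sqrt (1 - 3 * v))"
        using l v root_v by auto
      then show ?thesis using 1 by linarith
    next
      case 2
      have "sqrt (2 * l * s) \<le> sqrt (2 * l * (v + l))"
        using 2 l by (intro real_sqrt_le_mono mult_left_mono) auto
      moreover have "0 \<le> l * sqrt (1 - 3 * v)" using l root_v by auto
      ultimately show ?thesis using bernstein unfolding distrib_left by linarith
    qed
  next
    case True
    then have "0 < d" "v < s" "0 < s" using v by auto
    define c where "c = sqrt (l * (1 - 3 * s) / 2)"
    have "0 \<le> s * (1 - 3 * s)" using q by linarith
    then have s3: "0 \<le> 1 - 3 * s" using \<open>0 < s\<close> by (simp add: zero_le_mult_iff)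
    have c2: "c\<^sup>2 = l * (1 - 3 * s) / 2" using s3 l by (simp add: c_def)
    have "d\<^sup>2 < l / 2"
      using power_strict_mono[OF hoeffding, of 2] \<open>0 < d\<close> l by simp
    have "sqrt (2 * l * q) \<le> sqrt (s * (4 * (l * (1 - 3 * s) / 2)))"
      using mult_left_mono[OF q(2), of "2 * l"] l
      by (intro real_sqrt_le_mono) (simp add: algebra_simps)
    also have "\<dots> = sqrt s * (2 * c)"
      unfolding c_def real_sqrt_mult by simp
    finally have "s - (v + l / 2) < sqrt s * (2 * c)"
      using variance[OF \<open>0 < s\<close>] \<open>d\<^sup>2 < l / 2\<close> by linarith
    then have "(sqrt s - c)\<^sup>2 < v + l / 2 + c\<^sup>2"
      using s by (simp add: power2_eq_square algebra_simps)
    also have "\<dots> \<le> v + l"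
    proof -
      have "l * (1 - 3 * s) \<le> l * 1" using s l by (intro mult_left_mono) auto
      then show ?thesis unfolding c2 by simp
    qed
    finally have "sqrt s - c \<le> sqrt (v + l)"
      by (meson less_imp_le real_le_rsqrt)
    moreover have "c \<le> sqrt (l / 2 * (1 - 3 * v))"
      unfolding c_def using mult_left_mono[of "1 - 3 * s" "1 - 3 * v" "l / 2"] l \<open>v < s\<close>
      by (intro real_sqrt_le_mono) simp
    ultimately have "sqrt s \<le> sqrt (v + l) + sqrt (l / 2) * sqrt (1 - 3 * v)"
      by (simp only: real_sqrt_mult)
    then have "sqrt (2 * l) * sqrt s \<le> sqrt (2 * l) * (sqrt (v + l) + sqrt (l / 2) * sqrt (1 - 3 * v))"
      using l by (intro mult_left_mono) auto
    moreover have "sqrt (2 * l) * sqrt (l / 2) = l"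
      using l by (simp add: real_sqrt_mult[symmetric])
    ultimately have "sqrt (2 * l * s) \<le> sqrt (2 * l * (v + l)) + l * sqrt (1 - 3 * v)"
      unfolding real_sqrt_mult[of "2 * l" s] real_sqrt_mult[of "2 * l" "v + l"]
      by (simp add: distrib_left mult.assoc[symmetric])
    then show ?thesis using bernstein unfolding distrib_left by linarith
  qed
  then show ?thesis using hoeffding by (simp add: emp_bernstein_bound_def)
qed

lemma emp_var_eq_shifted:
  assumes "1 \<le> t"
  shows "emp_var x t = (\<Sum>i=1..t. (x i - c)\<^sup>2) / real t - (emp_mean x t - c)\<^sup>2"
proof -
  define a where "a = emp_mean x t"
  have S: "(\<Sum>i=1..t. x i) = real t * a"
    using assms by (simp add: a_def emp_mean_def)
  have expand: "(\<Sum>i=1..t. (x i - y)\<^sup>2) = (\<Sum>i=1..t. (x i)\<^sup>2) - 2 * y * (real t * a) + real t * y\<^sup>2" for y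
    unfolding S[symmetric]
    by (simp add: power2_diff sum.distrib sum_subtractf sum_distrib_left mult_ac)
  show ?thesis
    unfolding emp_var_def a_def[symmetric] expand using assms
    by (simp add: field_simps power2_eq_square)
qed

lemma emp_var_bounds:
  assumes t: "1 \<le> t" and x: "\<And>i. i \<in> {1..t} \<Longrightarrow> x i \<in> {0..1}"
  shows "0 \<le> emp_var x t" "emp_var x t \<le> 1 / 4"
proof -
  show "0 \<le> emp_var x t" by (auto simp: emp_var_def intro!: sum_nonneg divide_nonneg_nonneg)
  have "(\<Sum>i=1..t. (x i)\<^sup>2) \<le> (\<Sum>i=1..t. x i)"
    using x by (intro sum_mono) (force simp: power2_eq_square intro: mult_left_le)
  then have "(\<Sum>i=1..t. (x i)\<^sup>2) / real t \<le> emp_mean x t"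
    by (simp add: emp_mean_def divide_right_mono)
  then have "emp_var x t \<le> emp_mean x t - (emp_mean x t)\<^sup>2"
    using emp_var_eq_shifted[OF t, of x 0] by simp
  also have "\<dots> = 1 / 4 - (emp_mean x t - 1 / 2)\<^sup>2"
    by (simp add: power2_eq_square algebra_simps)
  finally show "emp_var x t \<le> 1 / 4"
    using zero_le_power2[of "emp_mean x t - 1 / 2"] by linarith
qed

lemma emp_mean_reflect:
  "1 \<le> t \<Longrightarrow> emp_mean (\<lambda>i. 1 - x i) t = 1 - emp_mean x t"
  by (simp add: emp_mean_def sum_subtractf diff_divide_distrib)

lemma emp_var_reflect:
  "1 \<le> t \<Longrightarrow> emp_var (\<lambda>i. 1 - x i) t = emp_var x t"
  by (simp add: emp_var_def emp_mean_reflect power2_commute)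

text \<open>
  Dividing bounds on partial sums by \<open>t\<close> produces the scale \<open>l = n * L / t\<^sup>2\<close>. The linear Bernstein
  term \<open>L / (3 * t)\<close> is only weakened to \<open>l / 3\<close>, as \<open>t \<le> n\<close>. The empirical variance is the mean of
  the \<open>(x i - m)\<^sup>2\<close> minus the squared deviation of the empirical mean.
\<close>

lemma emp_mean_deviation_less:
  fixes x :: "nat \<Rightarrow> real"
  assumes t: "t \<in> {1..n}" and L: "0 < L" and x: "\<And>i. i \<in> {1..t} \<Longrightarrow> x i \<in> {0..1}"
    and s: "0 \<le> s" and q: "0 \<le> q" "q \<le> s * (1 - 3 * s)"
    and dev: "(\<Sum>i=1..t. x i - m) < min (sqrt (2 * real n * s * L) + L / 3) (sqrt (real n * L / 2))"
    and var: "0 < s \<Longrightarrow> (\<Sum>i=1..t. s - (x i - m)\<^sup>2) < sqrt (2 * real n * q * L)"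
  shows "emp_mean x t - m < emp_bernstein_bound (real n * L / (real t)\<^sup>2) (emp_var x t)"
proof (rule less_emp_bernstein_bound)
  let ?l = "real n * L / (real t)\<^sup>2"
  have t1: "1 \<le> t" "0 < real t" "real t \<le> real n" using t by auto
  show "0 < ?l" using t1 L by simp
  show "0 \<le> emp_var x t" "emp_var x t \<le> 1 / 4" using emp_var_bounds[of t x] t1 x by auto
  have mean: "(\<Sum>i=1..t. x i - m) = real t * (emp_mean x t - m)"
    using t1 by (simp add: emp_mean_def sum_subtractf field_simps)
  have root: "sqrt (c * ?l) = sqrt (c * (n * L)) / t" for c
    using t1 by (simp add: real_sqrt_divide)
  show "emp_mean x t - m < sqrt (?l / 2)"
  proof -
    have "emp_mean x t - m < sqrt (1 / 2 * (n * L)) / t"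
      using dev[unfolded mean] t1 by (simp add: pos_less_divide_eq mult_ac)
    also have "\<dots> = sqrt (?l / 2)" using root[of "1 / 2"] by (simp add: mult_ac)
    finally show ?thesis .
  qed
  have "emp_mean x t - m < sqrt (2 * s * (n * L)) / t + L / (3 * t)"
    using dev[unfolded mean] t1 by (simp add: field_simps)
  also have "L / (3 * t) \<le> ?l / 3"
    using t1 L by (simp add: field_simps power2_eq_square)
  finally show "emp_mean x t - m < sqrt (2 * ?l * s) + ?l / 3"
    using root[of "2 * s"] by (simp add: mult_ac)
  show "s - (emp_var x t + (emp_mean x t - m)\<^sup>2) < sqrt (2 * ?l * q)" if "0 < s"
  proof -
    have "(\<Sum>i=1..t. s - (x i - m)\<^sup>2) = real t * (s - (emp_var x t + (emp_mean x t - m)\<^sup>2))"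
      using t1 by (simp add: emp_var_eq_shifted[of t x m] sum_subtractf field_simps)
    then have "s - (emp_var x t + (emp_mean x t - m)\<^sup>2) < sqrt (2 * q * (n * L)) / t"
      using var[OF that] t1 by (simp add: field_simps)
    then show ?thesis using root[of "2 * q"] by (simp add: mult_ac)
  qed
qed (use s q in auto)

section \<open>Deviation events of a sample in the unit interval\<close>

text \<open>
  Identical distribution enters only through the mean and the second and fourth central moments.
  This keeps the setting closed under the reflection \<open>x \<mapsto> 1 - x\<close>, which turns upper into lower
  deviations.
\<close>

locale unit_interval_sample = prob_space +
  fixes X :: "nat \<Rightarrow> 'a \<Rightarrow> real" and n :: nat and \<mu> \<sigma>2 \<kappa> :: real
  assumes indep: "indep_vars (\<lambda>_. borel) X {1..n}"
    and bounded: "\<And>i \<omega>. i \<in> {1..n} \<Longrightarrow> \<omega> \<in> space M \<Longrightarrow> X i \<omega> \<in> {0..1}"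
    and mean: "\<And>i. i \<in> {1..n} \<Longrightarrow> expectation (X i) = \<mu>"
    and variance: "\<And>i. i \<in> {1..n} \<Longrightarrow> expectation (\<lambda>\<omega>. (X i \<omega> - \<mu>)\<^sup>2) = \<sigma>2"
    and fourth_moment: "\<And>i. i \<in> {1..n} \<Longrightarrow> expectation (\<lambda>\<omega>. (X i \<omega> - \<mu>) ^ 4) = \<kappa>"
    and sample_nonempty: "1 \<le> n"
begin

lemma rv: "i \<in> {1..n} \<Longrightarrow> random_variable borel (X i)"
  using indep unfolding indep_vars_def by blast

lemma integrable_sample: "i \<in> {1..n} \<Longrightarrow> integrable M (X i)"
  using bounded rv by (intro integrable_const_bound[where B = 1]) auto

lemma mean_in_unit_interval: "\<mu> \<in> {0..1}"
proof -
  obtain i where i: "i \<in> {1..n}" using sample_nonempty by auto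
  have "0 \<le> expectation (X i)" using bounded[OF i] by (intro integral_nonneg_AE) auto
  moreover have "expectation (X i) \<le> expectation (\<lambda>_. 1)"
    using bounded[OF i] integrable_sample[OF i] by (intro integral_mono) auto
  ultimately show ?thesis using mean[OF i] by (simp add: prob_space)
qed

lemma centered_bounded: "i \<in> {1..n} \<Longrightarrow> \<omega> \<in> space M \<Longrightarrow> \<bar>X i \<omega> - \<mu>\<bar> \<le> 1"
  using bounded[of i \<omega>] mean_in_unit_interval by (auto simp: abs_le_iff)

lemma integrable_centered_power:
  assumes i: "i \<in> {1..n}"
  shows "integrable M (\<lambda>\<omega>. (X i \<omega> - \<mu>) ^ k)"
proof (rule integrable_const_bound[where B = 1])
  show "AE \<omega> in M. norm ((X i \<omega> - \<mu>) ^ k) \<le> 1"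
    using centered_bounded[OF i] by (auto simp: power_abs power_le_one)
qed (use rv[OF i] in measurable)

lemma variance_nonneg: "0 \<le> \<sigma>2"
proof -
  obtain i where i: "i \<in> {1..n}" using sample_nonempty by auto
  show ?thesis unfolding variance[OF i, symmetric] by (rule integral_nonneg_AE) auto
qed

lemma fourth_moment_bounds: "0 \<le> \<kappa>" "\<sigma>2\<^sup>2 \<le> \<kappa>" "\<kappa> \<le> \<sigma>2 * (1 - 3 * \<sigma>2)"
proof -
  obtain i where i: "i \<in> {1..n}" using sample_nonempty by auto
  show "\<sigma>2\<^sup>2 \<le> \<kappa>"
    using square_variance_le_fourth_moment[OF integrable_centered_power[OF i] integrable_centered_power[OF i]]
    by (simp add: variance[OF i] fourth_moment[OF i])
  then show "0 \<le> \<kappa>" using zero_le_power2[of \<sigma>2] by linarith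
  show "\<kappa> \<le> \<sigma>2 * (1 - 3 * \<sigma>2)"
    using fourth_central_moment_le[OF rv[OF i] bounded[OF i]]
    by (simp add: mean[OF i] variance[OF i] fourth_moment[OF i])
qed

lemma indep_compose:
  assumes "f \<in> borel_measurable borel"
  shows "indep_vars (\<lambda>_. borel) (\<lambda>i \<omega>. f (X i \<omega>) :: real) {1..n}"
  by (rule indep_vars_compose2[OF indep assms])

lemma hoeffding_deviation:
  assumes "0 < L"
  shows "prob {\<omega> \<in> space M. \<exists>t\<in>{1..n}. sqrt (real n * L / 2) \<le> (\<Sum>i=1..t. X i \<omega> - \<mu>)} \<le> exp (- L)"
proof -
  define s where "s = sqrt (real n * L / 2)"
  \<comment> \<open>This \<open>l\<close> minimises the exponent \<open>n * l\<^sup>2 / 8 - l * s\<close>.\<close>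
  define l where "l = 4 * s / n"
  have n: "0 < real n" using sample_nonempty by simp
  have s: "0 < s" "s\<^sup>2 = n * L / 2" using n assms by (auto simp: s_def)
  have l: "0 < l" using s n by (simp add: l_def)
  have int: "integrable M (\<lambda>\<omega>. exp (l * (X i \<omega> - \<mu>)))" if i: "i \<in> {1..n}" for i
  proof (rule integrable_const_bound[where B = "exp l"])
    show "AE \<omega> in M. norm (exp (l * (X i \<omega> - \<mu>))) \<le> exp l"
      using centered_bounded[OF i] l by (auto simp: mult_left_le abs_le_iff)
  qed (use rv[OF i] in measurable)
  have "prob {\<omega> \<in> space M. \<exists>t\<in>{1..n}. s \<le> (\<Sum>i=1..t. X i \<omega> - \<mu>)} \<le> exp (real n * (l\<^sup>2 / 8) - l * s)"
  proof (rule maximal_chernoff[OF indep_compose[of "\<lambda>x. x - \<mu>"]])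
    fix i assume i: "i \<in> {1..n}"
    interpret Xi: interval_bounded_random_variable M "X i" 0 1
      using rv[OF i] bounded[OF i] by unfold_locales auto
    have "ennreal (expectation (\<lambda>\<omega>. exp (l * (X i \<omega> - \<mu>)))) = (\<integral>\<^sup>+ \<omega>. exp (l * (X i \<omega> - \<mu>)) \<partial>M)"
      by (intro nn_integral_eq_integral[symmetric] int i) auto
    also have "\<dots> \<le> ennreal (exp (l\<^sup>2 / 8))"
      using Xi.Hoeffdings_lemma_nn_integral[OF l] by (simp add: mean[OF i])
    finally show "expectation (\<lambda>\<omega>. exp (l * (X i \<omega> - \<mu>))) \<le> exp (l\<^sup>2 / 8)"
      by simp
  qed (use l int in auto)
  also have "real n * (l\<^sup>2 / 8) - l * s = - (2 * s\<^sup>2 / n)"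
    using n by (simp add: l_def power2_eq_square field_simps)
  also have "\<dots> = - L" using n by (simp add: s(2))
  finally show ?thesis by (simp add: s_def)
qed

lemma bernstein_deviation:
  assumes L: "0 < L"
  shows "prob {\<omega> \<in> space M. \<exists>t\<in>{1..n}. sqrt (2 * real n * \<sigma>2 * L) + L / 3 \<le> (\<Sum>i=1..t. X i \<omega> - \<mu>)} \<le> exp (- L)"
    (is "?p \<le> _")
proof -
  have n: "0 < real n" using sample_nonempty by simp
  define r where "r = sqrt (2 * real n * \<sigma>2 * L)"
  have bound: "?p \<le> exp (n * (\<sigma>2 * (l\<^sup>2 / (2 * (1 - l / 3)))) - l * (r + L / 3))" if l: "0 \<le> l" "l < 3" for l
    unfolding r_def
  proof (rule maximal_chernoff[OF indep_compose[of "\<lambda>x. x - \<mu>"]])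
    fix i assume i: "i \<in> {1..n}"
    note rv[OF i, measurable]
    show "integrable M (\<lambda>\<omega>. exp (l * (X i \<omega> - \<mu>)))"
    proof (rule integrable_const_bound[where B = "exp l"])
      show "AE \<omega> in M. norm (exp (l * (X i \<omega> - \<mu>))) \<le> exp l"
        using centered_bounded[OF i] l by (auto simp: mult_left_le abs_le_iff)
    qed measurable
    have "expectation (\<lambda>\<omega>. X i \<omega> - \<mu>) = 0"
      using integrable_sample[OF i] by (simp add: mean[OF i] prob_space)
    from bernstein_mgf[OF _ centered_bounded[OF i] this l]
    show "expectation (\<lambda>\<omega>. exp (l * (X i \<omega> - \<mu>))) \<le> exp (\<sigma>2 * (l\<^sup>2 / (2 * (1 - l / 3))))"
      by (simp add: variance[OF i])
  qed (use l variance_nonneg in auto)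
  show ?thesis
  proof (cases "\<sigma>2 = 0")
    case True
    \<comment> \<open>Without variance the optimal parameter is the excluded endpoint \<open>3\<close>, reached as a limit.\<close>
    have "((\<lambda>l. exp (- (l * (L / 3)))) \<longlongrightarrow> exp (- (3 * (L / 3)))) (at_left 3)"
      by (intro tendsto_intros)
    moreover have "eventually (\<lambda>l. ?p \<le> exp (- (l * (L / 3)))) (at_left 3)"
      using eventually_at_left_real[of 0 3] by (rule eventually_mono) (use bound True in \<open>auto simp: r_def\<close>)
    ultimately have "?p \<le> exp (- (3 * (L / 3)))"
      by (intro tendsto_lowerbound) auto
    then show ?thesis by simp
  next
    case False
    \<comment> \<open>The \<open>l\<close> that minimises the exponent; it makes the exponent equal to \<open>- L\<close> exactly.\<close>
    define D where "D = n * \<sigma>2 + r / 3"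
    define l where "l = r / D"
    have v: "0 < n * \<sigma>2" using False variance_nonneg n by simp
    have r: "0 < r" "r * r = 2 * (n * \<sigma>2) * L"
      using v L by (auto simp: r_def mult_ac zero_less_mult_iff simp flip: power2_eq_square)
    have D: "0 < D" using r v by (simp add: D_def)
    have l: "0 \<le> l" "l < 3" using r v D by (auto simp: l_def D_def field_simps)
    have compl: "1 - l / 3 = n * \<sigma>2 / D"
    proof -
      have "1 - l / 3 = (D - r / 3) / D" using D by (simp add: l_def diff_divide_distrib)
      then show ?thesis by (simp add: D_def)
    qed
    have "n * (\<sigma>2 * (l\<^sup>2 / (2 * (1 - l / 3)))) = r * r / (2 * D)"
      unfolding compl unfolding l_def using D False n by (simp add: power2_eq_square divide_simps)
    also have "\<dots> - l * (r + L / 3) = - ((r * r / 2 + r * L / 3) / D)"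
      using D by (simp add: l_def field_simps)
    also have "r * r / 2 + r * L / 3 = L * D"
      unfolding r(2) by (simp add: D_def algebra_simps)
    also have "- (L * D / D) = - L" using D by simp
    finally show ?thesis using bound[OF l] by simp
  qed
qed

text \<open>
  The threshold is the minimum of the Bernstein and the Hoeffding level. Which of the two is smaller
  is decided by the deterministic numbers \<open>n\<close>, \<open>\<sigma>2\<close> and \<open>L\<close>, so one event of probability at most
  \<open>exp (- L)\<close> controls both bounds at once.
\<close>

definition upper_excess :: "real \<Rightarrow> 'a set" where
  "upper_excess L = {\<omega> \<in> space M. \<exists>t\<in>{1..n}.
      min (sqrt (2 * real n * \<sigma>2 * L) + L / 3) (sqrt (real n * L / 2)) \<le> (\<Sum>i=1..t. X i \<omega> - \<mu>)}"

lemma upper_deviation: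
  assumes "0 < L"
  shows "prob (upper_excess L) \<le> exp (- L)"
  using hoeffding_deviation[OF assms] bernstein_deviation[OF assms]
  unfolding upper_excess_def min_def
  by (cases "sqrt (2 * real n * \<sigma>2 * L) + L / 3 \<le> sqrt (real n * L / 2)") auto

text \<open>
  A degenerate sample is excluded explicitly: with \<open>\<sigma>2 = 0\<close> also \<open>\<kappa> = 0\<close>, so the threshold is \<open>0\<close>
  and would be attained almost surely.
\<close>

definition variance_deficit :: "real \<Rightarrow> 'a set" where
  "variance_deficit L = {\<omega> \<in> space M. 0 < \<sigma>2 \<and> (\<exists>t\<in>{1..n}.
      sqrt (2 * real n * \<kappa> * L) \<le> (\<Sum>i=1..t. \<sigma>2 - (X i \<omega> - \<mu>)\<^sup>2))}"

text \<open>
  The squares \<open>(X i - \<mu>)\<^sup>2\<close> are nonnegative with mean \<open>\<sigma>2\<close> and second moment \<open>\<kappa>\<close>, so their lower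
  tail is sub-Gaussian.
\<close>

lemma variance_lower_deviation:
  assumes L: "0 < L"
  shows "prob (variance_deficit L) \<le> exp (- L)"
proof (cases "0 < \<sigma>2")
  case True
  define s where "s = sqrt (2 * real n * \<kappa> * L)"
  \<comment> \<open>This \<open>l\<close> minimises the exponent \<open>n * l\<^sup>2 * \<kappa> / 2 - l * s\<close>.\<close>
  define l where "l = s / (n * \<kappa>)"
  have n: "0 < real n" using sample_nonempty by simp
  have "0 < \<sigma>2\<^sup>2" using True by simp
  then have k: "0 < \<kappa>" using fourth_moment_bounds(2) by linarith
  have s: "0 < s" "s * s = 2 * real n * \<kappa> * L" using n k L by (auto simp: s_def)
  have l: "0 < l" using s n k by (simp add: l_def)
  have "prob {\<omega> \<in> space M. \<exists>t\<in>{1..n}. s \<le> (\<Sum>i=1..t. \<sigma>2 - (X i \<omega> - \<mu>)\<^sup>2)}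
      \<le> exp (real n * (l\<^sup>2 * \<kappa> / 2) - l * s)"
  proof (rule maximal_chernoff[OF indep_compose[of "\<lambda>x. \<sigma>2 - (x - \<mu>)\<^sup>2"]])
    fix i assume i: "i \<in> {1..n}"
    note rv[OF i, measurable]
    show "integrable M (\<lambda>\<omega>. exp (l * (\<sigma>2 - (X i \<omega> - \<mu>)\<^sup>2)))"
    proof (rule integrable_const_bound[where B = "exp (l * \<sigma>2)"])
      show "AE \<omega> in M. norm (exp (l * (\<sigma>2 - (X i \<omega> - \<mu>)\<^sup>2))) \<le> exp (l * \<sigma>2)"
        using l by auto
    qed measurable
    have "integrable M (\<lambda>\<omega>. ((X i \<omega> - \<mu>)\<^sup>2)\<^sup>2)"
      using integrable_centered_power[OF i, of 4] by (simp flip: power_mult)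
    from nonneg_lower_mgf[OF _ _ integrable_centered_power[OF i] this, of l]
    show "expectation (\<lambda>\<omega>. exp (l * (\<sigma>2 - (X i \<omega> - \<mu>)\<^sup>2))) \<le> exp (l\<^sup>2 * \<kappa> / 2)"
      using l by (simp add: variance[OF i] fourth_moment[OF i] flip: power_mult)
  qed (use l k in auto)
  also have "real n * (l\<^sup>2 * \<kappa> / 2) - l * s = - (s * s / (2 * real n * \<kappa>))"
    using n k by (simp add: l_def power2_eq_square field_simps)
  also have "\<dots> = - L" using n k by (simp add: s(2))
  finally show ?thesis using True by (simp add: variance_deficit_def s_def)
qed (simp add: variance_deficit_def)

lemma partial_sum_event:
  assumes "f \<in> borel_measurable borel"
  shows "{\<omega> \<in> space M. \<exists>t\<in>{1..n}. c \<le> (\<Sum>i=1..t. f (X i \<omega>) :: real)} \<in> events"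
proof (intro sets.sets_Collect_finite_Ex borel_measurable_le borel_measurable_sum)
  fix i t assume "t \<in> {1..n}" "i \<in> {1..t}"
  then show "random_variable borel (\<lambda>\<omega>. f (X i \<omega>))"
    by (intro measurable_compose[OF rv assms]) auto
qed auto

lemma bernstein_event:
  fixes f :: "real \<Rightarrow> real"
  assumes f[measurable]: "f \<in> borel_measurable borel"
  shows "{\<omega> \<in> space M. \<forall>t\<in>{1..n}. f (emp_mean (\<lambda>i. X i \<omega>) t - \<mu>)
      < emp_bernstein_bound (real n * L / (real t)\<^sup>2) (emp_var (\<lambda>i. X i \<omega>) t)} \<in> events"
proof (intro sets.sets_Collect_finite_All borel_measurable_less)
  fix t assume t: "t \<in> {1..n}"
  have [measurable]: "random_variable borel (\<lambda>\<omega>. emp_mean (\<lambda>i. X i \<omega>) t)"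
    unfolding emp_mean_def using t rv by (intro borel_measurable_divide borel_measurable_sum) auto
  have [measurable]: "random_variable borel (\<lambda>\<omega>. emp_var (\<lambda>i. X i \<omega>) t)"
    unfolding emp_var_def using t rv
    by (intro borel_measurable_divide borel_measurable_sum borel_measurable_power borel_measurable_diff) auto
  show "random_variable borel (\<lambda>\<omega>. f (emp_mean (\<lambda>i. X i \<omega>) t - \<mu>))"
    by measurable
  show "random_variable borel (\<lambda>\<omega>. emp_bernstein_bound (real n * L / (real t)\<^sup>2) (emp_var (\<lambda>i. X i \<omega>) t))"
    unfolding emp_bernstein_bound_def by measurable
qed simp

lemma reflected: "unit_interval_sample M (\<lambda>i \<omega>. 1 - X i \<omega>) n (1 - \<mu>) \<sigma>2 \<kappa>"
proof unfold_locales
  show "indep_vars (\<lambda>_. borel) (\<lambda>i \<omega>. 1 - X i \<omega>) {1..n}"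
    by (rule indep_compose[of "\<lambda>x. 1 - x"]) measurable
  fix i assume i: "i \<in> {1..n}"
  show "expectation (\<lambda>\<omega>. 1 - X i \<omega>) = 1 - \<mu>"
    using integrable_sample[OF i] by (simp add: mean[OF i] prob_space)
  have eq: "1 - X i \<omega> - (1 - \<mu>) = - (X i \<omega> - \<mu>)" for \<omega> by simp
  show "expectation (\<lambda>\<omega>. (1 - X i \<omega> - (1 - \<mu>))\<^sup>2) = \<sigma>2"
    unfolding eq power_minus_Bit0 by (rule variance[OF i])
  show "expectation (\<lambda>\<omega>. (1 - X i \<omega> - (1 - \<mu>)) ^ 4) = \<kappa>"
    unfolding eq power_minus_Bit0 by (rule fourth_moment[OF i])
qed (use bounded sample_nonempty in auto)

section \<open>Empirical Bernstein bounds\<close>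

lemma upper_excess_event: "upper_excess L \<in> events"
  unfolding upper_excess_def by (rule partial_sum_event[of "\<lambda>x. x - \<mu>"]) measurable

lemma variance_deficit_event: "variance_deficit L \<in> events"
proof -
  let ?S = "{\<omega> \<in> space M. \<exists>t\<in>{1..n}. sqrt (2 * real n * \<kappa> * L) \<le> (\<Sum>i=1..t. \<sigma>2 - (X i \<omega> - \<mu>)\<^sup>2)}"
  have S: "?S \<in> events"
    by (rule partial_sum_event[of "\<lambda>x. \<sigma>2 - (x - \<mu>)\<^sup>2"]) measurable
  show ?thesis
  proof (cases "0 < \<sigma>2")
    case True
    then show ?thesis unfolding variance_deficit_def using S by (simp only: simp_thms)
  next
    case False
    then show ?thesis by (simp add: variance_deficit_def)
  qed
qed

lemma deviation_less_outside:
  assumes "0 < L" and \<omega>: "\<omega> \<in> space M" "\<omega> \<notin> upper_excess L" "\<omega> \<notin> variance_deficit L" and t: "t \<in> {1..n}"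
  shows "emp_mean (\<lambda>i. X i \<omega>) t - \<mu>
    < emp_bernstein_bound (real n * L / (real t)\<^sup>2) (emp_var (\<lambda>i. X i \<omega>) t)"
proof (rule emp_mean_deviation_less[OF t \<open>0 < L\<close> _ variance_nonneg fourth_moment_bounds(1,3)])
  show "(\<Sum>i=1..t. X i \<omega> - \<mu>)
      < min (sqrt (2 * real n * \<sigma>2 * L) + L / 3) (sqrt (real n * L / 2))"
    using \<omega> t unfolding upper_excess_def mem_Collect_eq not_le[symmetric] by blast
  show "(\<Sum>i=1..t. \<sigma>2 - (X i \<omega> - \<mu>)\<^sup>2) < sqrt (2 * real n * \<kappa> * L)" if "0 < \<sigma>2"
    using \<omega> t that unfolding variance_deficit_def mem_Collect_eq not_le[symmetric] by blast
  show "X i \<omega> \<in> {0..1}" if "i \<in> {1..t}" for i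
    using bounded[OF _ \<omega>(1)] t that by auto
qed

theorem empirical_bernstein_upper:
  assumes L: "0 < L"
  shows "1 - 2 * exp (- L) \<le> prob {\<omega> \<in> space M. \<forall>t\<in>{1..n}. emp_mean (\<lambda>i. X i \<omega>) t - \<mu>
      < emp_bernstein_bound (real n * L / (real t)\<^sup>2) (emp_var (\<lambda>i. X i \<omega>) t)}"
    (is "_ \<le> prob ?good")
proof -
  let ?bad = "upper_excess L \<union> variance_deficit L"
  have events: "?bad \<in> events" by (intro sets.Un upper_excess_event variance_deficit_event)
  have "prob ?bad \<le> prob (upper_excess L) + prob (variance_deficit L)"
    by (intro measure_Un_le upper_excess_event variance_deficit_event)
  also have "\<dots> \<le> 2 * exp (- L)"
    using upper_deviation[OF L] variance_lower_deviation[OF L] by simp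
  finally have "1 - 2 * exp (- L) \<le> prob (space M - ?bad)"
    by (simp add: prob_compl[OF events])
  also have "\<dots> \<le> prob ?good"
  proof (intro finite_measure_mono subsetI CollectI conjI ballI)
    fix \<omega> t assume "\<omega> \<in> space M - ?bad" "t \<in> {1..n}"
    then show "emp_mean (\<lambda>i. X i \<omega>) t - \<mu>
        < emp_bernstein_bound (real n * L / (real t)\<^sup>2) (emp_var (\<lambda>i. X i \<omega>) t)"
      by (intro deviation_less_outside[OF L]) auto
  qed (use bernstein_event[of "\<lambda>d. d" L] in simp_all)
  finally show ?thesis .
qed

text \<open>
  Three events suffice instead of four, since reflection leaves the centred squares, and with
  them the variance event, unchanged.
\<close>

theorem empirical_bernstein_two_sided:
  assumes L: "0 < L"
  shows "1 - 3 * exp (- L) \<le> prob {\<omega> \<in> space M. \<forall>t\<in>{1..n}. \<bar>emp_mean (\<lambda>i. X i \<omega>) t - \<mu>\<bar>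
      < emp_bernstein_bound (real n * L / (real t)\<^sup>2) (emp_var (\<lambda>i. X i \<omega>) t)}"
    (is "_ \<le> prob ?good")
proof -
  interpret R: unit_interval_sample M "\<lambda>i \<omega>. 1 - X i \<omega>" n "1 - \<mu>" \<sigma>2 \<kappa>
    by (rule reflected)
  have same_deficit: "R.variance_deficit L = variance_deficit L"
    unfolding R.variance_deficit_def variance_deficit_def by (simp add: power2_commute)
  let ?bad = "upper_excess L \<union> R.upper_excess L \<union> variance_deficit L"
  have events: "?bad \<in> events"
    by (intro sets.Un upper_excess_event R.upper_excess_event variance_deficit_event)
  have "prob ?bad \<le> prob (upper_excess L \<union> R.upper_excess L) + prob (variance_deficit L)"
    by (intro measure_Un_le sets.Un upper_excess_event R.upper_excess_event variance_deficit_event)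
  also have "prob (upper_excess L \<union> R.upper_excess L) \<le> prob (upper_excess L) + prob (R.upper_excess L)"
    by (intro measure_Un_le upper_excess_event R.upper_excess_event)
  finally have "prob ?bad \<le> 3 * exp (- L)"
    using upper_deviation[OF L] R.upper_deviation[OF L] variance_lower_deviation[OF L]
    by linarith
  then have "1 - 3 * exp (- L) \<le> prob (space M - ?bad)"
    by (simp add: prob_compl[OF events])
  also have "\<dots> \<le> prob ?good"
  proof (intro finite_measure_mono subsetI CollectI conjI ballI)
    fix \<omega> t assume \<omega>: "\<omega> \<in> space M - ?bad" and t: "t \<in> {1..n}"
    have "emp_mean (\<lambda>i. 1 - X i \<omega>) t - (1 - \<mu>)
        < emp_bernstein_bound (real n * L / (real t)\<^sup>2) (emp_var (\<lambda>i. 1 - X i \<omega>) t)"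
      using \<omega> t same_deficit by (intro R.deviation_less_outside[OF L]) auto
    then show "\<bar>emp_mean (\<lambda>i. X i \<omega>) t - \<mu>\<bar>
        < emp_bernstein_bound (real n * L / (real t)\<^sup>2) (emp_var (\<lambda>i. X i \<omega>) t)"
      using deviation_less_outside[OF L, of \<omega> t] \<omega> t
      by (auto simp: emp_mean_reflect emp_var_reflect abs_less_iff)
  qed (use bernstein_event[of abs L] in simp_all)
  finally show ?thesis .
qed

end

theorem lemma21:
  fixes M :: "'a measure" and U :: "'a \<Rightarrow> real" and X :: "nat \<Rightarrow> 'a \<Rightarrow> real" and n :: nat
  assumes "prob_space M"
    and "n \<ge> 1"
    and "prob_space.indep_vars M (\<lambda>_. borel) (X(0 := U)) {0..n}"
    and "\<And>i. i \<in> {1..n} \<Longrightarrow> distr M borel (X i) = distr M borel U"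
    and "\<And>\<omega>. \<omega> \<in> space M \<Longrightarrow> U \<omega> \<in> {0..1}"
    and "\<And>i \<omega>. i \<in> {1..n} \<Longrightarrow> \<omega> \<in> space M \<Longrightarrow> X i \<omega> \<in> {0..1}"
  shows "(\<forall>\<epsilon>>0. measure M {\<omega> \<in> space M. \<forall>t\<in>{1..n}.
            emp_mean (\<lambda>i. X i \<omega>) t - integral\<^sup>L M U
              < emp_bernstein_bound (real n * ln (2 / \<epsilon>) / (real t)\<^sup>2) (emp_var (\<lambda>i. X i \<omega>) t)}
          \<ge> 1 - \<epsilon>) \<and>
         (\<forall>\<epsilon>>0. measure M {\<omega> \<in> space M. \<forall>t\<in>{1..n}.
            \<bar>emp_mean (\<lambda>i. X i \<omega>) t - integral\<^sup>L M U\<bar>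
              < emp_bernstein_bound (real n * ln (3 / \<epsilon>) / (real t)\<^sup>2) (emp_var (\<lambda>i. X i \<omega>) t)}
          \<ge> 1 - \<epsilon>)"
proof -
  interpret prob_space M by (rule assms(1))
  define \<mu> where "\<mu> = expectation U"
  define \<sigma>2 where "\<sigma>2 = expectation (\<lambda>\<omega>. (U \<omega> - \<mu>)\<^sup>2)"
  define \<kappa> where "\<kappa> = expectation (\<lambda>\<omega>. (U \<omega> - \<mu>) ^ 4)"
  have "indep_vars (\<lambda>_. borel) (X(0 := U)) {1..n}"
    by (rule indep_vars_subset[OF assms(3)]) auto
  then have indepX: "indep_vars (\<lambda>_. borel) X {1..n}"
    by (subst indep_vars_cong[of _ _ _ "X(0 := U)" _ "\<lambda>_. borel"]) auto
  have [measurable]: "random_variable borel U"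
  proof -
    have "\<forall>i\<in>{0..n}. random_variable borel ((X(0 := U)) i)"
      using assms(3) unfolding indep_vars_def by blast
    from this[rule_format, of 0] show ?thesis by simp
  qed
  have moment: "expectation (\<lambda>\<omega>. f (X i \<omega>)) = expectation (\<lambda>\<omega>. f (U \<omega>))"
    if i: "i \<in> {1..n}" and [measurable]: "f \<in> borel_measurable borel" for f :: "real \<Rightarrow> real" and i
  proof -
    have [measurable]: "random_variable borel (X i)"
      using indepX i by (auto simp: indep_vars_def)
    have "expectation (\<lambda>\<omega>. f (X i \<omega>)) = integral\<^sup>L (distr M borel (X i)) f"
      by (simp add: integral_distr)
    also have "\<dots> = expectation (\<lambda>\<omega>. f (U \<omega>))"
      unfolding assms(4)[OF i] by (simp add: integral_distr)
    finally show ?thesis .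
  qed
  interpret unit_interval_sample M X n \<mu> \<sigma>2 \<kappa>
    using indepX assms(2,6) moment[of _ "\<lambda>x. x"] moment[of _ "\<lambda>x. (x - \<mu>)\<^sup>2"] moment[of _ "\<lambda>x. (x - \<mu>) ^ 4"]
    by unfold_locales (auto simp: \<mu>_def \<sigma>2_def \<kappa>_def)
  have log_level: "0 < ln (c / \<epsilon>)" "exp (- ln (c / \<epsilon>)) = \<epsilon> / c" if "0 < \<epsilon>" "\<epsilon> < 1" "1 < c" for \<epsilon> c :: real
    using that by (auto simp: exp_minus)
  show ?thesis
  proof (intro conjI allI impI)
    fix \<epsilon> :: real assume "0 < \<epsilon>"
    show "1 - \<epsilon> \<le> prob {\<omega> \<in> space M. \<forall>t\<in>{1..n}. emp_mean (\<lambda>i. X i \<omega>) t - expectation U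
        < emp_bernstein_bound (real n * ln (2 / \<epsilon>) / (real t)\<^sup>2) (emp_var (\<lambda>i. X i \<omega>) t)}"
    \<comment> \<open>For \<open>\<epsilon> \<ge> 1\<close> the logarithm may be negative, but then the claimed probability is at most \<open>0\<close>.\<close>
    proof (cases "\<epsilon> < 1")
      case True
      then show ?thesis
        using empirical_bernstein_upper[of "ln (2 / \<epsilon>)"] log_level[of \<epsilon> 2] \<open>0 < \<epsilon>\<close> by (simp add: \<mu>_def)
    qed (simp add: order_trans[OF _ measure_nonneg])
    show "1 - \<epsilon> \<le> prob {\<omega> \<in> space M. \<forall>t\<in>{1..n}. \<bar>emp_mean (\<lambda>i. X i \<omega>) t - expectation U\<bar>
        < emp_bernstein_bound (real n * ln (3 / \<epsilon>) / (real t)\<^sup>2) (emp_var (\<lambda>i. X i \<omega>) t)}"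
    proof (cases "\<epsilon> < 1")
      case True
      then show ?thesis
        using empirical_bernstein_two_sided[of "ln (3 / \<epsilon>)"] log_level[of \<epsilon> 3] \<open>0 < \<epsilon>\<close> by (simp add: \<mu>_def)
    qed (simp add: order_trans[OF _ measure_nonneg])
  qed
qed

end
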